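(* Let $H$ be a real Hilbert space, $T:H\to 2^H$ maximal monotone with $S:=T^{-1}(0)\neq\emptyset$, and $\mathsf{J}_\rho=(I+\rho T)^{-1}$ for $\rho>0$. Let $u,z_0\in H$, $(c_n)$ positive reals, $(\lambda_n),(\gamma_n),(\delta_n)\subset(0,1)$ with $\lambda_n+\gamma_n+\delta_n=1$, $(e_n)\subset H$, and $z_{n+1}=\lambda_n u+\gamma_n z_n+\delta_n\mathsf{J}_{c_n}(z_n)+e_n$. Assume there are $a,c\in\mathbb{N}\setminus\{0\}$ and monotone $\ell,L,E:\mathbb{N}\to\mathbb{N}$ with: (Q1) $\forall k\,\forall n\ge\ell(k)\ (\lambda_n\le\frac{1}{k+1})$; (Q2) $\forall k\ (\sum_{i=1}^{L(k)}\lambda_i\ge k)$; (Q3) $\forall m\ (\frac1a\le\gamma_m\le1-\frac1a)$; (Q4) $\forall n\ (c_n\ge\frac1c)$; (Q6) $\forall k,n\ (\sum_{i=E(k)+1}^{E(k)+n}\|e_i\|\le\frac{1}{k+1})$. Let $\mathcal{C}:\mathbb{N}\to\mathbb{N}$ be monotone with $c_n\le\mathcal{C}(n)$ for all $n$. Let $N_2,N_3\in\mathbb{N}$ with $N_2\ge\sum_{i=0}^{E(0)}\|e_i\|+1$ and, for some $s\in S$, $N_3\ge\max\{\|u-s\|,\|z_0-s\|\}$. Let $(w_n)\subset H$ satisfy $z_{n+1}=\gamma_nz_n+(1-\gamma_n)w_n$ for all $n$, and let $\chi:\mathbb{N}\times\mathbb{N}^{\mathbb{N}}\to\mathbb{N}$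 be a monotone functional such that $$\forall k\ \tilde\forall f\ \exists n\le\chi(k,f)\ \forall m\in[n,n+f(n)]\ \Big(\|w_m-z_m\|\le\frac{1}{k+1}\Big).$$ Then $$\forall k\in\mathbb{N}\ \tilde\forall f:\mathbb{N}\to\mathbb{N}\ \exists n\le\phi_\chi(k,f)\ \forall i,j\in[n,n+f(n)]\ \Big(\|z_i-z_j\|\le\frac1{k+1}\Big),$$ with $\phi_\chi$ as defined in the context.
   Context: $\tilde\forall f$ means "for all monotone (nondecreasing) $f:\mathbb{N}\to\mathbb{N}$". For $f,g:\mathbb{N}\to\mathbb{N}$, $g\le^* f$ means $\forall n\,\forall m\le n\,(g(m)\le f(n)\wedge f(m)\le f(n))$; a functional $\Phi:\mathbb{N}\times\mathbb{N}^{\mathbb{N}}\to\mathbb{N}$ is monotone if $\Phi(m,g)\le\Phi(n,f)$ whenever $m\le n$ and $g\le^* f$. $[x,y]$ is the set of naturals between $x$ and $y$; $f+1$ is $m\mapsto f(m)+1$; $f^{(r)}$ is the $r$-fold iterate; $\ln$ natural log. Define: $N_0:=N_2+N_3$, $N:=\max\{2N_3,N_2+N_3\}$. $\mu(k):=\max\{\ell(4a(k+1)(N_0+N_3)),\ E(4a(k+1))+1\}$; $\tilde f_k(m):=\mu(k)+f(\max\{\mu(k),m\})$; $\xi_\chi(k,f):=\max\{\mu(2k+1),\ \chi(4a(k+1),\tilde f_{2k+1})\}$. For $k,f$: $R:=4N^4(k+1)^2$, $g_f(m):=f(\xi_\chi(m,f+1))$, $\check g_f(m):=\max\{g_f(24N(m+1)^2),24N(m+1)^2\}$,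 $\psi_\chi(k,f):=\xi_\chi(24N(\check g_f^{(R)}(0)+1)^2,\ f+1)$. $\zeta(k,n):=\mathcal{C}(n)c(k+1)-1$; $h_f(m):=\zeta((1+4N)(f(m)+1)-1,f(m))$; $\Psi_\chi(k,f):=\psi_\chi(2k+1,h_f)$. $M_1:=3N_2+4N$, $M_2:=M_1+2(N_3+N)$, $G(k):=E(M_2(k+1))$, $D:=4N^2$. For $k$ and monotone $f$: $h'(m):=\max\{m,G(4k+3)+1\}+\lceil\ln(4D(k+1))\rceil$, $g'(m):=4(k+1)(f(L(h'(m))+1)+1)$, $\Theta(k,f):=L(h'(\Psi_\chi(4k+3,g')))+1$. $\phi_\chi(k,f):=\Theta(4(k+1)^2-1,\ m\mapsto m+f(m))$. *)

theory Defs
  imports "HOL-Analysis.Analysis"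
begin

definition op_graph :: "('a \<Rightarrow> 'b set) \<Rightarrow> ('a \<times> 'b) set" where
  "op_graph T = {(x, v). v \<in> T x}"

definition op_inverse :: "('a \<Rightarrow> 'b set) \<Rightarrow> 'b \<Rightarrow> 'a set" where
  "op_inverse T v = {x. v \<in> T x}"

definition monotone_operator :: "('a::real_inner \<Rightarrow> 'a set) \<Rightarrow> bool" where
  "monotone_operator T \<longleftrightarrow>
     (\<forall>x y v w. v \<in> T x \<longrightarrow> w \<in> T y \<longrightarrow> 0 \<le> (x - y) \<bullet> (v - w))"

definition maximal_monotone :: "('a::real_inner \<Rightarrow> 'a set) \<Rightarrow> bool" where
  "maximal_monotone T \<longleftrightarrow> monotone_operator T \<and>
     (\<forall>T'. monotone_operator T' \<longrightarrow> \<not> op_graph T \<subset> op_graph T')"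

definition id_plus_scaled :: "real \<Rightarrow> ('a::real_vector \<Rightarrow> 'a set) \<Rightarrow> 'a \<Rightarrow> 'a set" where
  "id_plus_scaled \<rho> T x = {x + \<rho> *\<^sub>R v | v. v \<in> T x}"

text \<open>
  For maximal monotone \<open>T\<close> on a Hilbert space and \<open>\<rho> > 0\<close>, Minty's theorem says that
  \<open>op_inverse (id_plus_scaled \<rho> T) x\<close> is a singleton for every \<open>x\<close>. The resolvent is its
  element; in all other situations its value is not meaningful.
\<close>

definition resolvent :: "('a::real_vector \<Rightarrow> 'a set) \<Rightarrow> real \<Rightarrow> 'a \<Rightarrow> 'a" where
  "resolvent T \<rho> x = (THE y. y \<in> op_inverse (id_plus_scaled \<rho> T) x)"

definition le_star :: "(nat \<Rightarrow> nat) \<Rightarrow> (nat \<Rightarrow> nat) \<Rightarrow> bool" (infix "\<le>\<^sup>*" 50) where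
  "g \<le>\<^sup>* f \<longleftrightarrow> (\<forall>n. \<forall>m\<le>n. g m \<le> f n \<and> f m \<le> f n)"

definition monotone_functional :: "(nat \<Rightarrow> (nat \<Rightarrow> nat) \<Rightarrow> nat) \<Rightarrow> bool" where
  "monotone_functional \<Phi> \<longleftrightarrow> (\<forall>m n g f. m \<le> n \<longrightarrow> g \<le>\<^sup>* f \<longrightarrow> \<Phi> m g \<le> \<Phi> n f)"

text \<open>
  The locale only bundles the parameters and carries no assumptions. Outside of it, the final
  bound is \<open>rates.phi a c N2 N3 l L E C chi\<close>. The truncated subtractions and the conversion
  \<open>nat \<lceil>ln _\<rceil>\<close> are exact as soon as \<open>N2\<close>, \<open>c\<close> and all values of \<open>C\<close> are positive.
\<close>

locale rates =
  fixes a c N2 N3 :: nat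
    and l L E C :: "nat \<Rightarrow> nat"
    and chi :: "nat \<Rightarrow> (nat \<Rightarrow> nat) \<Rightarrow> nat"
begin

definition N0 :: nat where "N0 = N2 + N3"

definition N :: nat where "N = max (2 * N3) (N2 + N3)"

definition mu :: "nat \<Rightarrow> nat" where
  "mu k = max (l (4 * a * (k + 1) * (N0 + N3))) (E (4 * a * (k + 1)) + 1)"

definition ftilde :: "nat \<Rightarrow> (nat \<Rightarrow> nat) \<Rightarrow> nat \<Rightarrow> nat" where
  "ftilde k f m = mu k + f (max (mu k) m)"

definition xi :: "nat \<Rightarrow> (nat \<Rightarrow> nat) \<Rightarrow> nat" where
  "xi k f = max (mu (2 * k + 1)) (chi (4 * a * (k + 1)) (ftilde (2 * k + 1) f))"

definition R :: "nat \<Rightarrow> nat" where "R k = 4 * N ^ 4 * (k + 1)\<^sup>2"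

definition g_of :: "(nat \<Rightarrow> nat) \<Rightarrow> nat \<Rightarrow> nat" where
  "g_of f m = f (xi m (\<lambda>i. f i + 1))"

definition gcheck :: "(nat \<Rightarrow> nat) \<Rightarrow> nat \<Rightarrow> nat" where
  "gcheck f m = max (g_of f (24 * N * (m + 1)\<^sup>2)) (24 * N * (m + 1)\<^sup>2)"

definition psi :: "nat \<Rightarrow> (nat \<Rightarrow> nat) \<Rightarrow> nat" where
  "psi k f = xi (24 * N * ((gcheck f ^^ R k) 0 + 1)\<^sup>2) (\<lambda>i. f i + 1)"

definition zeta :: "nat \<Rightarrow> nat \<Rightarrow> nat" where
  "zeta k n = C n * c * (k + 1) - 1"

definition h_of :: "(nat \<Rightarrow> nat) \<Rightarrow> nat \<Rightarrow> nat" where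
  "h_of f m = zeta ((1 + 4 * N) * (f m + 1) - 1) (f m)"

definition Psi :: "nat \<Rightarrow> (nat \<Rightarrow> nat) \<Rightarrow> nat" where
  "Psi k f = psi (2 * k + 1) (h_of f)"

definition M1 :: nat where "M1 = 3 * N2 + 4 * N"

definition M2 :: nat where "M2 = M1 + 2 * (N3 + N)"

definition G :: "nat \<Rightarrow> nat" where "G k = E (M2 * (k + 1))"

definition D :: nat where "D = 4 * N\<^sup>2"

definition h' :: "nat \<Rightarrow> nat \<Rightarrow> nat" where
  "h' k m = max m (G (4 * k + 3) + 1) + nat \<lceil>ln (real (4 * D * (k + 1)))\<rceil>"

definition g' :: "nat \<Rightarrow> (nat \<Rightarrow> nat) \<Rightarrow> nat \<Rightarrow> nat" where
  "g' k f m = 4 * (k + 1) * (f (L (h' k m) + 1) + 1)"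

definition Theta :: "nat \<Rightarrow> (nat \<Rightarrow> nat) \<Rightarrow> nat" where
  "Theta k f = L (h' k (Psi (4 * k + 3) (g' k f))) + 1"

definition phi :: "nat \<Rightarrow> (nat \<Rightarrow> nat) \<Rightarrow> nat" where
  "phi k f = Theta (4 * (k + 1)\<^sup>2 - 1) (\<lambda>m. m + f m)"

end

end

(*
  The resolvents are everywhere defined by Minty's theorem, obtained by minimising the Fitzpatrick
  function plus half the squared norm; the minimising sequence is Cauchy by the parallelogram law.
  The rate chi for w_n - z_n yields a rate xi for the displacement of z_n under the resolvents.
  Instead of projecting u onto the zeros of T, one moves from a zero s towards the z_n finitely often
  to reach an approximate fixed point x with <u - x, z_m - x> almost nonpositive on a long interval
  of indices. There the squared distances to x satisfy, up to small errors, the recursion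
  d_{m+1} <= (1 - lambda_m) d_m + lambda_m b, and the divergence of the sum of the lambda_m makes
  them small.
*)
theory Submission
  imports Defs
begin

section \<open>Minty's theorem and resolvents\<close>

text \<open>The point \<open>x\<close> that stands in for the projection need only be good enough
  for the stretch of indices that \<open>f\<close> demands, but every step of the recursion on that
  stretch adds an error because \<open>x\<close> is only nearly fixed. So the accuracy asked of
  \<open>x\<close> depends on \<open>n\<close>, while \<open>n\<close> depends on the accuracy asked
  of the iterates; feeding \<open>f\<close> into nested functionals breaks this circle. The varying
  resolvents are compared with the single nonexpansive map \<open>resolvent T (1 / real c)\<close>.
  Its approximate fixed points can be combined convexly at the price of a square root in accuracy,
  which is the origin of the square in \<open>24 * N * (m + 1)\<^sup>2\<close>. The number of moves
  \<open>R k\<close> comes from a squared distance that drops by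
  \<open>1 / (4 * N\<^sup>2 * (k + 1)\<^sup>2)\<close> each time.\<close>

lemma norm_add_scaleR_sq:
  "(norm (p + x *\<^sub>R d))\<^sup>2 = (norm p)\<^sup>2 + 2 * x * (p \<bullet> d) + x\<^sup>2 * (norm d)\<^sup>2"
  for p d :: "'a::real_inner"
  unfolding power2_norm_eq_inner
  by (simp add: inner_add_left inner_add_right inner_commute algebra_simps power2_eq_square)

text \<open>The conclusion is the first-order condition at a minimiser of
  \<open>t + (norm p)\<^sup>2 / 2\<close>. Only \<open>p\<close> enters quadratically, so the Cauchy
  argument covers that component alone; the real component converges as the difference of the values
  and the quadratic terms.\<close>

lemma closed_convex_min:
  fixes A :: "('b::{real_inner, complete_space} \<times> real) set"
  assumes "closed A" "convex A" "A \<noteq> {}"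
    and bdd: "\<And>p t. (p, t) \<in> A \<Longrightarrow> m \<le> t + (norm p)\<^sup>2 / 2"
  obtains p t where "(p, t) \<in> A" "\<And>q r. (q, r) \<in> A \<Longrightarrow> t + (norm p)\<^sup>2 \<le> r + p \<bullet> q"
proof -
  define V where "V = (\<lambda>a::'b \<times> real. snd a + (norm (fst a))\<^sup>2 / 2)"
  define I where "I = Inf (V ` A)"
  have bb: "bdd_below (V ` A)"
    using bdd by (auto simp: V_def intro!: bdd_belowI[of _ m])
  have ne: "V ` A \<noteq> {}" using assms(3) by simp
  have I_le: "I \<le> V a" if "a \<in> A" for a
    unfolding I_def using bb that by (intro cInf_lower) auto
  have "\<exists>a\<in>A. V a < I + 1 / real (Suc n)" for n
  proof -
    have "Inf (V ` A) < I + 1 / real (Suc n)" by (simp add: I_def)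
    then show ?thesis using cInf_lessD[OF ne] by blast
  qed
  then obtain s where s: "\<And>n. s n \<in> A" "\<And>n. V (s n) < I + 1 / real (Suc n)" by metis
  \<comment> \<open>At the midpoint the value lies below the average of the two values by an eighth
    of the squared distance of the first components.\<close>
  have mid: "(norm (fst a - fst b))\<^sup>2 \<le> 4 * ((V a - I) + (V b - I))"
    if "a \<in> A" "b \<in> A" for a b
  proof -
    have "(1/2) *\<^sub>R a + (1/2) *\<^sub>R b \<in> A"
      using convexD[OF assms(2) that, of "1/2" "1/2"] by simp
    from I_le[OF this] show ?thesis
      by (simp add: V_def power2_norm_eq_inner inner_add_left inner_add_right
          inner_diff_left inner_diff_right inner_commute field_simps)
  qed
  have "Cauchy (\<lambda>n. fst (s n))"
  proof (rule metric_CauchyI)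
    fix \<epsilon> :: real assume e: "0 < \<epsilon>"
    obtain M where M: "8 / \<epsilon>\<^sup>2 < real (Suc M)"
      using reals_Archimedean2 by (metis less_Suc_eq of_nat_less_iff order_less_trans)
    have "dist (fst (s i)) (fst (s j)) < \<epsilon>" if "M \<le> i" "M \<le> j" for i j
    proof -
      have i: "1 / real (Suc i) \<le> 1 / real (Suc M)" "1 / real (Suc j) \<le> 1 / real (Suc M)"
        using that by (auto intro!: divide_left_mono)
      have "(norm (fst (s i) - fst (s j)))\<^sup>2 < 4 * (1 / real (Suc i) + 1 / real (Suc j))"
        using mid[OF s(1) s(1), of i j] s(2)[of i] s(2)[of j] by simp
      also have "\<dots> \<le> 8 / real (Suc M)" using i by simp
      also have "\<dots> < \<epsilon>\<^sup>2"
        using M e by (simp add: field_simps)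
      finally show ?thesis using e power2_less_imp_less[of _ \<epsilon>] by (simp add: dist_norm)
    qed
    then show "\<exists>M. \<forall>m\<ge>M. \<forall>n\<ge>M. dist (fst (s m)) (fst (s n)) < \<epsilon>" by blast
  qed
  then obtain p where p: "(\<lambda>n. fst (s n)) \<longlonglongrightarrow> p"
    using Cauchy_convergent convergent_def by blast
  have "(\<lambda>n. V (s n)) \<longlonglongrightarrow> I"
  proof (rule tendsto_sandwich)
    show "\<forall>\<^sub>F n in sequentially. I \<le> V (s n)" using s(1) I_le by auto
    show "\<forall>\<^sub>F n in sequentially. V (s n) \<le> I + 1 / real (Suc n)"
      using s(2) by (auto intro!: always_eventually less_imp_le)
    show "(\<lambda>n. I + 1 / real (Suc n)) \<longlonglongrightarrow> I"
      using tendsto_add[OF tendsto_const[of I] LIMSEQ_inverse_real_of_nat]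
      by (simp add: inverse_eq_divide)
  qed auto
  then have "(\<lambda>n. V (s n) - (norm (fst (s n)))\<^sup>2 / 2) \<longlonglongrightarrow> I - (norm p)\<^sup>2 / 2"
    using p by (intro tendsto_intros) auto
  then have "(\<lambda>n. snd (s n)) \<longlonglongrightarrow> I - (norm p)\<^sup>2 / 2" by (simp add: V_def)
  with p have "s \<longlonglongrightarrow> (p, I - (norm p)\<^sup>2 / 2)"
    using tendsto_Pair by fastforce
  then have pA: "(p, I - (norm p)\<^sup>2 / 2) \<in> A"
    using assms(1) s(1) closed_sequentially by blast
  have "I - (norm p)\<^sup>2 / 2 + (norm p)\<^sup>2 \<le> r + p \<bullet> q" if qr: "(q, r) \<in> A" for q r
  proof (rule ccontr)
    define d where "d = I + (norm p)\<^sup>2 / 2 - r - p \<bullet> q"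
    assume "\<not> ?thesis"
    then have d: "0 < d" by (simp add: d_def)
    \<comment> \<open>\<open>d\<close> is the amount by which the inequality fails. A step of length
      \<open>x\<close> towards \<open>(q, r)\<close> gains \<open>x * d\<close> to first order, and
      this choice keeps the quadratic loss to at most half of that. The \<open>+ 1\<close> covers
      \<open>q = p\<close>.\<close>
    define x where "x = min 1 (d / ((norm (q - p))\<^sup>2 + 1))"
    have x: "0 < x" "x \<le> 1" using d by (auto simp: x_def add_nonneg_pos)
    have "x * (norm (q - p))\<^sup>2 \<le> d / ((norm (q - p))\<^sup>2 + 1) * (norm (q - p))\<^sup>2"
      by (intro mult_right_mono) (auto simp: x_def)
    also have "\<dots> \<le> d"
      using d by (simp add: field_simps add_pos_nonneg)
    finally have xd: "x * (norm (q - p))\<^sup>2 \<le> d" .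
    have "(1 - x) *\<^sub>R (p, I - (norm p)\<^sup>2 / 2) + x *\<^sub>R (q, r) \<in> A"
      using convexD[OF assms(2) pA qr] x by simp
    from I_le[OF this]
    have "I \<le> (1 - x) * (I - (norm p)\<^sup>2 / 2) + x * r + (norm ((1 - x) *\<^sub>R p + x *\<^sub>R q))\<^sup>2 / 2"
      by (simp add: V_def)
    also have "(1 - x) *\<^sub>R p + x *\<^sub>R q = p + x *\<^sub>R (q - p)"
      by (simp add: algebra_simps)
    also have "(norm (p + x *\<^sub>R (q - p)))\<^sup>2
        = (norm p)\<^sup>2 + 2 * x * (p \<bullet> q - (norm p)\<^sup>2) + x * (x * (norm (q - p))\<^sup>2)"
      unfolding norm_add_scaleR_sq
      by (simp add: inner_diff_right power2_norm_eq_inner) (simp add: power2_eq_square)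
    finally have "0 \<le> x * (x * (norm (q - p))\<^sup>2 / 2 - d)"
      by (simp add: d_def algebra_simps add_divide_distrib diff_divide_distrib)
    then have "d \<le> x * (norm (q - p))\<^sup>2 / 2"
      using x by (simp add: zero_le_mult_iff)
    with xd d show False by simp
  qed
  with pA show ?thesis by (intro that[of p "I - (norm p)\<^sup>2 / 2"])
qed

text \<open>Adding the pair \<open>(x, v)\<close> keeps the graph monotone, so by maximality it is
  there already.\<close>

lemma maximal_monotone_memI:
  assumes "maximal_monotone T" "\<And>y w. w \<in> T y \<Longrightarrow> 0 \<le> (x - y) \<bullet> (v - w)"
  shows "v \<in> T x"
proof (rule ccontr)
  assume n: "v \<notin> T x"
  define T' where "T' = (\<lambda>y. if y = x then insert v (T y) else T y)"
  have "monotone_operator T'"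
    unfolding monotone_operator_def
  proof (intro allI impI)
    fix y1 y2 w1 w2 assume h: "w1 \<in> T' y1" "w2 \<in> T' y2"
    have sym: "(a - b) \<bullet> (c - d) = (b - a) \<bullet> (d - c)" for a b c d :: 'a
      by (simp add: inner_diff_left inner_diff_right)
    have "w1 \<in> T y1 \<or> (y1 = x \<and> w1 = v)" "w2 \<in> T y2 \<or> (y2 = x \<and> w2 = v)"
      using h by (auto simp: T'_def split: if_splits)
    then show "0 \<le> (y1 - y2) \<bullet> (w1 - w2)"
      using assms sym[of y1 x w1 v]
      by (auto simp: maximal_monotone_def monotone_operator_def)
  qed
  moreover have "op_graph T \<subset> op_graph T'"
    using n by (auto simp: op_graph_def T'_def split: if_splits)
  ultimately show False using assms(1) by (auto simp: maximal_monotone_def)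
qed

text \<open>
  The convex set below is the epigraph of the Fitzpatrick function of \<open>T\<close>, which lies above
  the duality product; minimising it plus half the squared norm gives the desired point.
\<close>

lemma minty_zero:
  fixes T :: "'a::{real_inner, complete_space} \<Rightarrow> 'a set"
  assumes mon: "\<And>x y v w. v \<in> T x \<Longrightarrow> w \<in> T y \<Longrightarrow> 0 \<le> (x - y) \<bullet> (v - w)"
    and mx: "\<And>x v. (\<And>y w. w \<in> T y \<Longrightarrow> 0 \<le> (x - y) \<bullet> (v - w)) \<Longrightarrow> v \<in> T x"
  shows "\<exists>x. - x \<in> T x"
proof -
  define A where "A = {b :: ('a \<times> 'a) \<times> real. \<forall>y w. w \<in> T y \<longrightarrow>
     fst (fst b) \<bullet> w + y \<bullet> snd (fst b) - y \<bullet> w \<le> snd b}"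
  have A_eq: "A = (\<Inter>y. \<Inter>w\<in>T y. {b. fst (fst b) \<bullet> w + y \<bullet> snd (fst b) - y \<bullet> w \<le> snd b})"
    by (auto simp: A_def)
  have "closed A"
    unfolding A_eq by (intro closed_INT ballI closed_Collect_le continuous_intros)
  moreover have "convex A"
  proof (rule convexI)
    fix b b' :: "('a \<times> 'a) \<times> real" and s t :: real
    assume b: "b \<in> A" "b' \<in> A" and st: "0 \<le> s" "0 \<le> t" "s + t = 1"
    show "s *\<^sub>R b + t *\<^sub>R b' \<in> A"
      unfolding A_def
    proof (intro CollectI allI impI)
      fix y w assume w: "w \<in> T y"
      have "s * (fst (fst b) \<bullet> w + y \<bullet> snd (fst b) - y \<bullet> w)
          + t * (fst (fst b') \<bullet> w + y \<bullet> snd (fst b') - y \<bullet> w) \<le> s * snd b + t * snd b'"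
        using b w st by (intro add_mono mult_left_mono) (auto simp: A_def)
      moreover have "y \<bullet> w = s * (y \<bullet> w) + t * (y \<bullet> w)"
        using st by (simp flip: distrib_right)
      ultimately show "fst (fst (s *\<^sub>R b + t *\<^sub>R b')) \<bullet> w + y \<bullet> snd (fst (s *\<^sub>R b + t *\<^sub>R b')) - y \<bullet> w
          \<le> snd (s *\<^sub>R b + t *\<^sub>R b')"
        by (simp add: inner_add_left inner_add_right algebra_simps)
    qed
  qed
  moreover have inA: "((y, w), y \<bullet> w) \<in> A" if "w \<in> T y" for y w
    using mon[OF that] by (auto simp: A_def inner_diff_left inner_diff_right algebra_simps)
  moreover have "A \<noteq> {}"
  proof -
    \<comment> \<open>If \<open>T\<close> had no values, the premise of \<open>mx\<close> would hold
      vacuously and produce one.\<close>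
    have "\<exists>y w. w \<in> T y" using mx by blast
    then show ?thesis using inA by blast
  qed
  \<comment> \<open>If \<open>t < x \<bullet> v\<close>, the constraints make \<open>(x, v)\<close>
    monotonically related to the whole graph, hence a member of it, and the constraint at
    \<open>(x, v)\<close> itself reads \<open>x \<bullet> v \<le> t\<close>.\<close>
  moreover have Fge: "x \<bullet> v \<le> t" if b: "((x, v), t) \<in> A" for x v t
  proof (rule ccontr)
    assume lt: "\<not> x \<bullet> v \<le> t"
    have bw: "x \<bullet> w + y \<bullet> v - y \<bullet> w \<le> t" if "w \<in> T y" for y w
      using b that by (auto simp: A_def)
    have "v \<in> T x"
    proof (rule mx)
      fix y w assume "w \<in> T y"
      with bw lt show "0 \<le> (x - y) \<bullet> (v - w)"
        by (force simp: inner_diff_left inner_diff_right)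
    qed
    with bw lt show False by force
  qed
  moreover have "0 \<le> t + (norm p)\<^sup>2 / 2" if "(p, t) \<in> A" for p t
  proof -
    obtain x v where [simp]: "p = (x, v)" by (cases p)
    have "0 \<le> (norm (x + v))\<^sup>2" by simp
    also have "\<dots> = (norm p)\<^sup>2 + 2 * (x \<bullet> v)"
      by (simp add: power2_norm_eq_inner inner_add_left inner_add_right inner_commute)
    finally show ?thesis using Fge[of x v t] that by simp
  qed
  ultimately obtain p t where pt: "(p, t) \<in> A"
    and min: "\<And>q r. (q, r) \<in> A \<Longrightarrow> t + (norm p)\<^sup>2 \<le> r + p \<bullet> q"
    using closed_convex_min[of A 0] by metis
  obtain x v where p: "p = (x, v)" by (cases p)
  \<comment> \<open>The first-order condition at graph points shows that \<open>(- v, - x)\<close>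
    is monotonically related to the graph, with excess \<open>(norm (x + v))\<^sup>2\<close>. Once
    this pair is in the graph, testing with the pair itself makes the excess vanish.\<close>
  have key: "(norm (x + v))\<^sup>2 \<le> (- v - y) \<bullet> (- x - w)" if "w \<in> T y" for y w
    using min[OF inA[OF that]] Fge[OF pt[unfolded p]]
    by (simp add: p power2_norm_eq_inner inner_add_left inner_add_right inner_diff_left
        inner_diff_right inner_commute algebra_simps)
  have "- x \<in> T (- v)"
  proof (rule mx)
    fix y w assume "w \<in> T y"
    from key[OF this] show "0 \<le> (- v - y) \<bullet> (- x - w)"
      by (meson order_trans zero_le_power2)
  qed
  with key[OF this] have "x + v = 0" by simp
  then have "- v = x" by (simp add: add_eq_0_iff2)
  with \<open>- x \<in> T (- v)\<close> show ?thesis by auto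
qed

theorem minty:
  fixes T :: "'a::{real_inner, complete_space} \<Rightarrow> 'a set"
  assumes T: "maximal_monotone T" and r: "0 < \<rho>"
  shows "\<exists>y. (1 / \<rho>) *\<^sub>R (x - y) \<in> T y"
proof -
  \<comment> \<open>\<open>- y \<in> T' y\<close> means
    \<open>x \<in> id_plus_scaled \<rho> T y\<close>; scaling and translation preserve both
    hypotheses of \<open>minty_zero\<close>.\<close>
  define T' where "T' = (\<lambda>y. {\<rho> *\<^sub>R w - x | w. w \<in> T y})"
  have "\<exists>y. - y \<in> T' y"
  proof (rule minty_zero)
    fix y y' v v' assume "v \<in> T' y" "v' \<in> T' y'"
    then obtain w w' where w: "w \<in> T y" "w' \<in> T y'" "v = \<rho> *\<^sub>R w - x" "v' = \<rho> *\<^sub>R w' - x"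
      by (auto simp: T'_def)
    have "v - v' = \<rho> *\<^sub>R (w - w')" by (simp add: w(3,4) algebra_simps)
    moreover have "0 \<le> (y - y') \<bullet> (w - w')"
      using T w by (auto simp: maximal_monotone_def monotone_operator_def)
    ultimately show "0 \<le> (y - y') \<bullet> (v - v')" using r by simp
  next
    fix y v assume h: "\<And>y' v'. v' \<in> T' y' \<Longrightarrow> 0 \<le> (y - y') \<bullet> (v - v')"
    have "(1 / \<rho>) *\<^sub>R (v + x) \<in> T y"
    proof (rule maximal_monotone_memI[OF T])
      fix y' w' assume "w' \<in> T y'"
      then have "0 \<le> (y - y') \<bullet> (v - (\<rho> *\<^sub>R w' - x))" by (intro h) (auto simp: T'_def)
      also have "v - (\<rho> *\<^sub>R w' - x) = \<rho> *\<^sub>R ((1 / \<rho>) *\<^sub>R (v + x) - w')"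
        using r by (simp add: algebra_simps)
      finally show "0 \<le> (y - y') \<bullet> ((1 / \<rho>) *\<^sub>R (v + x) - w')"
        using r by (simp add: zero_le_mult_iff)
    qed
    moreover have "v = \<rho> *\<^sub>R ((1 / \<rho>) *\<^sub>R (v + x)) - x" using r by simp
    ultimately show "v \<in> T' y" unfolding T'_def by blast
  qed
  then obtain y w where w: "w \<in> T y" "- y = \<rho> *\<^sub>R w - x" by (auto simp: T'_def)
  then have "x - y = \<rho> *\<^sub>R w" by (simp add: algebra_simps)
  then have "(1 / \<rho>) *\<^sub>R (x - y) = w" using r by simp
  with w show ?thesis by auto
qed

section \<open>Resolvents: fixed points, nonexpansiveness, dependence on the parameter\<close>

lemma resolvent_eqI:
  assumes T: "monotone_operator T" and r: "0 < \<rho>" and v: "v \<in> T y"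
  shows "resolvent T \<rho> (y + \<rho> *\<^sub>R v) = y"
  unfolding resolvent_def
proof (rule the_equality)
  show "y \<in> op_inverse (id_plus_scaled \<rho> T) (y + \<rho> *\<^sub>R v)"
    using v by (auto simp: op_inverse_def id_plus_scaled_def)
next
  fix y' assume "y' \<in> op_inverse (id_plus_scaled \<rho> T) (y + \<rho> *\<^sub>R v)"
  then obtain v' where v': "v' \<in> T y'" "y + \<rho> *\<^sub>R v = y' + \<rho> *\<^sub>R v'"
    by (auto simp: op_inverse_def id_plus_scaled_def)
  \<comment> \<open>Uniqueness for the description operator: inserting this into monotonicity forces
    \<open>(norm (v - v'))\<^sup>2 \<le> 0\<close>.\<close>
  have "y' - y = \<rho> *\<^sub>R (v - v')" using v'(2) by (simp add: algebra_simps)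
  moreover have "0 \<le> (y' - y) \<bullet> (v' - v)"
    using T v v' by (auto simp: monotone_operator_def)
  ultimately have "0 \<le> \<rho> * ((v - v') \<bullet> (v' - v))" by simp
  also have "(v - v') \<bullet> (v' - v) = - (norm (v - v'))\<^sup>2"
    by (simp add: power2_norm_eq_inner inner_diff_left inner_diff_right)
  finally have "v = v'" using r by (simp add: mult_le_0_iff)
  with v' show "y' = y" by simp
qed

lemma resolvent_mem:
  fixes T :: "'a::{real_inner, complete_space} \<Rightarrow> 'a set"
  assumes "maximal_monotone T" "0 < \<rho>"
  shows "(1 / \<rho>) *\<^sub>R (x - resolvent T \<rho> x) \<in> T (resolvent T \<rho> x)"
proof -
  obtain y where y: "(1 / \<rho>) *\<^sub>R (x - y) \<in> T y" using minty[OF assms] by blast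
  have "resolvent T \<rho> x = y"
    using resolvent_eqI[of T \<rho> _ y, OF _ assms(2) y] assms by (simp add: maximal_monotone_def)
  with y show ?thesis by simp
qed

lemma resolvent_fixed:
  assumes "monotone_operator T" "0 < \<rho>" "s \<in> op_inverse T 0"
  shows "resolvent T \<rho> s = s"
  using resolvent_eqI[of T \<rho> 0 s] assms by (simp add: op_inverse_def)

text \<open>Monotonicity gives firm nonexpansiveness,
  \<open>(norm (p - q))\<^sup>2 \<le> (p - q) \<bullet> (x - y)\<close>, and Cauchy-Schwarz does the
  rest.\<close>

lemma resolvent_nonexpansive:
  fixes T :: "'a::{real_inner, complete_space} \<Rightarrow> 'a set"
  assumes "maximal_monotone T" "0 < \<rho>"
  shows "norm (resolvent T \<rho> x - resolvent T \<rho> y) \<le> norm (x - y)"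
proof -
  define p q where "p = resolvent T \<rho> x" and "q = resolvent T \<rho> y"
  have "0 \<le> (p - q) \<bullet> ((1 / \<rho>) *\<^sub>R (x - p) - (1 / \<rho>) *\<^sub>R (y - q))"
    using resolvent_mem[OF assms, of x] resolvent_mem[OF assms, of y] assms(1)
    by (auto simp: maximal_monotone_def monotone_operator_def p_def q_def)
  also have "(1 / \<rho>) *\<^sub>R (x - p) - (1 / \<rho>) *\<^sub>R (y - q) = (1 / \<rho>) *\<^sub>R ((x - y) - (p - q))"
    by (simp add: algebra_simps)
  finally have "0 \<le> (p - q) \<bullet> ((x - y) - (p - q))"
    using assms(2) by (simp add: zero_le_divide_iff)
  then have "(norm (p - q))\<^sup>2 \<le> (p - q) \<bullet> (x - y)"
    by (simp add: power2_norm_eq_inner inner_diff_right)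
  also have "\<dots> \<le> norm (p - q) * norm (x - y)" by (rule norm_cauchy_schwarz)
  finally have "norm (p - q) * norm (p - q) \<le> norm (p - q) * norm (x - y)"
    by (simp add: power2_eq_square)
  then show ?thesis
    unfolding p_def q_def by (metis mult_le_cancel_left_pos norm_ge_zero order_le_less)
qed

text \<open>Monotonicity at the two resolvents and Cauchy-Schwarz make
  \<open>(norm q - norm p) * (\<sigma> * norm p - \<rho> * norm q)\<close> nonnegative;
  \<open>\<sigma> \<le> \<rho>\<close> then forces both factors to be nonpositive.\<close>

lemma resolvent_displacement:
  fixes T :: "'a::{real_inner, complete_space} \<Rightarrow> 'a set"
  assumes T: "maximal_monotone T" and s: "0 < \<sigma>" "\<sigma> \<le> \<rho>"
  shows "norm (resolvent T \<sigma> x - x) \<le> norm (resolvent T \<rho> x - x)"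
    and "\<sigma> * norm (resolvent T \<rho> x - x) \<le> \<rho> * norm (resolvent T \<sigma> x - x)"
proof -
  define p q where "p = x - resolvent T \<rho> x" and "q = x - resolvent T \<sigma> x"
  have r: "0 < \<rho>" using s by simp
  have "0 \<le> (q - p) \<bullet> ((1 / \<rho>) *\<^sub>R p - (1 / \<sigma>) *\<^sub>R q)"
    using resolvent_mem[OF T r, of x] resolvent_mem[OF T s(1), of x] T
    unfolding maximal_monotone_def monotone_operator_def p_def q_def
    by (metis (no_types, lifting) add_diff_cancel_left' diff_diff_eq2 diff_add_cancel)
  then have "0 \<le> (\<rho> * \<sigma>) * ((q - p) \<bullet> ((1 / \<rho>) *\<^sub>R p - (1 / \<sigma>) *\<^sub>R q))"
    using r s by simp
  also have "\<dots> = (\<rho> + \<sigma>) * (p \<bullet> q) - \<sigma> * (norm p)\<^sup>2 - \<rho> * (norm q)\<^sup>2"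
    using r s by (simp add: inner_diff_left inner_diff_right power2_norm_eq_inner inner_commute field_simps)
  also have "\<dots> \<le> (\<rho> + \<sigma>) * (norm p * norm q) - \<sigma> * (norm p)\<^sup>2 - \<rho> * (norm q)\<^sup>2"
    using r s norm_cauchy_schwarz[of p q] by (simp add: mult_left_mono)
  also have "\<dots> = (norm q - norm p) * (\<sigma> * norm p - \<rho> * norm q)"
    by (simp add: algebra_simps power2_eq_square)
  finally have *: "0 \<le> (norm q - norm p) * (\<sigma> * norm p - \<rho> * norm q)" .
  have "norm q \<le> norm p \<and> \<sigma> * norm p \<le> \<rho> * norm q"
  proof (cases "norm p \<le> norm q")
    case True
    have "\<sigma> * norm p \<le> \<rho> * norm q" using s r True by (intro mult_mono) auto
    moreover have "norm q \<le> norm p"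
    proof (rule ccontr)
      assume n: "\<not> norm q \<le> norm p"
      with * have "\<rho> * norm q \<le> \<sigma> * norm p" by (simp add: zero_le_mult_iff)
      also have "\<dots> \<le> \<rho> * norm p" using s by (intro mult_right_mono) auto
      finally show False using n r by simp
    qed
    ultimately show ?thesis by simp
  next
    case False
    with * show ?thesis by (auto simp: zero_le_mult_iff)
  qed
  then show "norm (resolvent T \<sigma> x - x) \<le> norm (resolvent T \<rho> x - x)"
    and "\<sigma> * norm (resolvent T \<rho> x - x) \<le> \<rho> * norm (resolvent T \<sigma> x - x)"
    by (simp_all add: p_def q_def norm_minus_commute)
qed


section \<open>Approximate fixed points and approximate projections\<close>

text \<open>\<open>J w\<close> is within \<open>t * d + \<delta>\<close> of \<open>x\<close> and
  \<open>(1 - t) * d + \<delta>\<close> of \<open>y\<close>, where \<open>d\<close> is their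
  distance. The identity for the squared distance to a point of a segment then leaves little room
  away from \<open>w\<close>.\<close>

lemma approx_fixed_convex:
  fixes J :: "'a::real_inner \<Rightarrow> 'a"
  assumes ne: "\<And>x y. norm (J x - J y) \<le> norm (x - y)"
    and x: "norm (J x - x) \<le> \<delta>" and y: "norm (J y - y) \<le> \<delta>"
    and t: "0 \<le> t" "t \<le> 1" and w: "w = (1 - t) *\<^sub>R x + t *\<^sub>R y"
  shows "(norm (J w - w))\<^sup>2 \<le> \<delta> * norm (x - y) + \<delta>\<^sup>2"
proof -
  define d where "d = norm (x - y)"
  have d: "0 \<le> d" by (simp add: d_def)
  have \<delta>: "0 \<le> \<delta>" using x norm_ge_zero order_trans by blast
  have "w - x = (- t) *\<^sub>R (x - y)" "w - y = (1 - t) *\<^sub>R (x - y)"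
    by (simp_all add: w algebra_simps)
  then have wx: "norm (w - x) = t * d" "norm (w - y) = (1 - t) * d"
    using t by (simp_all add: d_def)
  have Jx: "norm (J w - x) \<le> t * d + \<delta>"
    using norm_triangle_ineq[of "J w - J x" "J x - x"] ne[of w x] x wx by simp
  have Jy: "norm (J w - y) \<le> (1 - t) * d + \<delta>"
    using norm_triangle_ineq[of "J w - J y" "J y - y"] ne[of w y] y wx by simp
  have "(norm (J w - w))\<^sup>2 = (1 - t) * (norm (J w - x))\<^sup>2 + t * (norm (J w - y))\<^sup>2 - t * (1 - t) * d\<^sup>2"
    unfolding w d_def power2_norm_eq_inner
    by (simp add: inner_add_left inner_add_right inner_diff_left inner_diff_right inner_commute
        algebra_simps power2_eq_square)
  also have "\<dots> \<le> (1 - t) * (t * d + \<delta>)\<^sup>2 + t * ((1 - t) * d + \<delta>)\<^sup>2 - t * (1 - t) * d\<^sup>2"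
    using t Jx Jy by (intro diff_right_mono add_mono mult_left_mono power_mono) auto
  also have "\<dots> = \<delta> * d * (4 * t * (1 - t)) + \<delta>\<^sup>2"
    by (simp add: algebra_simps power2_eq_square)
  also have "\<dots> \<le> \<delta> * d * 1 + \<delta>\<^sup>2"
  proof -
    have "0 \<le> (2 * t - 1)\<^sup>2" by simp
    then have "4 * t * (1 - t) \<le> 1" by (simp add: algebra_simps power2_eq_square)
    then show ?thesis using d \<delta> by (intro add_right_mono mult_left_mono) auto
  qed
  finally show ?thesis by (simp add: d_def)
qed

text \<open>The squared distance to \<open>u\<close> along the segment is a quadratic in
  \<open>t\<close> with minimiser \<open>P / q\<close>. If this exceeds 1, then \<open>t = 1\<close>
  gains \<open>2 * P - q > P > \<eta>\<close>, which is enough because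
  \<open>\<eta> \<le> d\<^sup>2\<close>.\<close>

lemma projection_step:
  fixes u x y :: "'a::real_inner"
  assumes p: "\<eta> < (u - x) \<bullet> (y - x)" and \<eta>: "0 < \<eta>" "\<eta> \<le> d\<^sup>2" and d: "norm (y - x) \<le> d"
  obtains t where "0 \<le> t" "t \<le> 1"
    "(norm (u - ((1 - t) *\<^sub>R x + t *\<^sub>R y)))\<^sup>2 \<le> (norm (u - x))\<^sup>2 - \<eta>\<^sup>2 / d\<^sup>2"
proof -
  define P q where "P = (u - x) \<bullet> (y - x)" and "q = (norm (y - x))\<^sup>2"
  have eq: "(norm (u - ((1 - t) *\<^sub>R x + t *\<^sub>R y)))\<^sup>2 = (norm (u - x))\<^sup>2 - 2 * t * P + t\<^sup>2 * q" for t
  proof -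
    have "u - ((1 - t) *\<^sub>R x + t *\<^sub>R y) = (u - x) + (- t) *\<^sub>R (y - x)"
      by (simp add: algebra_simps)
    then show ?thesis unfolding P_def q_def by (simp only: norm_add_scaleR_sq) simp
  qed
  have P: "\<eta> < P" "0 < P" using p \<eta> by (auto simp: P_def)
  have q: "q \<le> d\<^sup>2" unfolding q_def using d by (intro power_mono) auto
  have d0: "0 < d\<^sup>2" using \<eta> by (rule less_le_trans)
  show ?thesis
  proof (cases "P \<le> q")
    case True
    have "\<eta>\<^sup>2 / d\<^sup>2 \<le> P\<^sup>2 / q"
      using P q True \<eta> by (intro frac_le power_mono) auto
    moreover have "2 * (P / q) * P - (P / q)\<^sup>2 * q = P\<^sup>2 / q"
      using P True by (simp add: field_simps power2_eq_square)
    ultimately show ?thesis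
      using True P by (intro that[of "P / q"]) (auto simp: eq)
  next
    case False
    have "\<eta>\<^sup>2 / d\<^sup>2 \<le> \<eta>"
      using \<eta> d0 by (simp add: power2_eq_square pos_divide_le_eq mult_left_mono)
    then show ?thesis using False P eq[of 1] by (intro that[of 1]) auto
  qed
qed

section \<open>The iteration\<close>

text \<open>One zero \<open>s\<close> is fixed as a parameter: all bounds on the iterates are
  centred at it, and the search in \<open>psi_rate\<close> starts from it.\<close>

locale multi_parameter_ppa = rates a c N2 N3 l L E C chi
  for a c N2 N3 :: nat
    and l L E C :: "nat \<Rightarrow> nat"
    and chi :: "nat \<Rightarrow> (nat \<Rightarrow> nat) \<Rightarrow> nat" +
  fixes T :: "'a::{real_inner, complete_space} \<Rightarrow> 'a set"
    and u s :: 'a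
    and z w e :: "nat \<Rightarrow> 'a"
    and cs lam gam del :: "nat \<Rightarrow> real"
  assumes T: "maximal_monotone T"
    and cs_pos: "\<And>n. 0 < cs n"
    and lam: "\<And>n. lam n \<in> {0<..<1}"
    and gam: "\<And>n. gam n \<in> {0<..<1}"
    and del: "\<And>n. del n \<in> {0<..<1}"
    and sum1: "\<And>n. lam n + gam n + del n = 1"
    and z: "\<And>n. z (Suc n) =
              lam n *\<^sub>R u + gam n *\<^sub>R z n + del n *\<^sub>R resolvent T (cs n) (z n) + e n"
    and a_pos: "a \<noteq> 0"
    and c_pos: "c \<noteq> 0"
    and l_mono: "mono l"
    and L_mono: "mono L"
    and E_mono: "mono E"
    and Q1: "\<And>k n. l k \<le> n \<Longrightarrow> lam n \<le> 1 / (real k + 1)"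
    and Q2: "\<And>k. real k \<le> (\<Sum>i=1..L k. lam i)"
    and Q3: "\<And>m. gam m \<le> 1 - 1 / real a"
    and Q4: "\<And>n. 1 / real c \<le> cs n"
    and Q6: "\<And>k n. (\<Sum>i=E k + 1..E k + n. norm (e i)) \<le> 1 / (real k + 1)"
    and C_mono: "mono C"
    and C: "\<And>n. cs n \<le> real (C n)"
    and N2: "(\<Sum>i=0..E 0. norm (e i)) + 1 \<le> real N2"
    and s: "s \<in> op_inverse T 0" "norm (u - s) \<le> real N3" "norm (z 0 - s) \<le> real N3"
    and w: "\<And>n. z (Suc n) = gam n *\<^sub>R z n + (1 - gam n) *\<^sub>R w n"
    and chi_mono: "monotone_functional chi"
    and chi_rate: "\<And>k f. mono f \<Longrightarrow>
                \<exists>n\<le>chi k f. \<forall>m\<in>{n..n + f n}. norm (w m - z m) \<le> 1 / (real k + 1)"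
begin

section \<open>Bounds on the iterates and on the tails of the error series\<close>

lemma N2_pos: "1 \<le> N2"
proof -
  have "0 \<le> (\<Sum>i=0..E 0. norm (e i))" by (simp add: sum_nonneg)
  with N2 show ?thesis by simp
qed

lemma N_bounds: "1 \<le> N" "N0 \<le> N" "2 * N3 \<le> N"
  using N2_pos by (auto simp: N_def N0_def)

lemma J_fixed: "0 < \<rho> \<Longrightarrow> resolvent T \<rho> s = s"
  using resolvent_fixed[of T \<rho> s] s(1) T by (simp add: maximal_monotone_def)

lemma J_bound: "0 < \<rho> \<Longrightarrow> norm (resolvent T \<rho> x - s) \<le> norm (x - s)"
  using resolvent_nonexpansive[OF T, of \<rho> x s] J_fixed[of \<rho>] by simp

lemma sum_errors: "(\<Sum>i<n. norm (e i)) \<le> real N2"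
proof -
  have "(\<Sum>i<n. norm (e i)) \<le> (\<Sum>i\<in>{0..E 0} \<union> {E 0 + 1..E 0 + n}. norm (e i))"
    by (intro sum_mono2) auto
  also have "\<dots> = (\<Sum>i=0..E 0. norm (e i)) + (\<Sum>i=E 0 + 1..E 0 + n. norm (e i))"
    by (intro sum.union_disjoint) auto
  finally show ?thesis using Q6[of 0 n] N2 by simp
qed

lemma sum_tail_errors:
  assumes "E k < n"
  shows "(\<Sum>i=n..<m. norm (e i)) \<le> 1 / (real k + 1)"
proof -
  have "(\<Sum>i=n..<m. norm (e i)) \<le> (\<Sum>i=E k + 1..E k + m. norm (e i))"
    using assms by (intro sum_mono2) auto
  with Q6[of k m] show ?thesis by simp
qed

text \<open>Up to \<open>e n\<close>, the next iterate is a convex combination of \<open>u\<close>,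
  \<open>z n\<close> and the image of \<open>z n\<close> under a nonexpansive map fixing
  \<open>s\<close>, so only the errors can accumulate.\<close>

lemma z_bound: "norm (z n - s) \<le> real N0"
proof -
  have "norm (z n - s) \<le> real N3 + (\<Sum>i<n. norm (e i))"
  proof (induction n)
    case 0
    then show ?case using s by simp
  next
    case (Suc n)
    have pos: "0 < lam n" "0 < gam n" "0 < del n" using lam[of n] gam[of n] del[of n] by auto
    define B where "B = real N3 + (\<Sum>i<n. norm (e i))"
    have B: "real N3 \<le> B" by (simp add: B_def sum_nonneg)
    have lg: "gam n = 1 - lam n - del n" using sum1[of n] by simp
    have "z (Suc n) - s = lam n *\<^sub>R (u - s) + gam n *\<^sub>R (z n - s)
        + del n *\<^sub>R (resolvent T (cs n) (z n) - s) + e n"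
      unfolding z lg by (simp add: algebra_simps)
    also have "norm \<dots> \<le> lam n * norm (u - s) + gam n * norm (z n - s)
        + del n * norm (resolvent T (cs n) (z n) - s) + norm (e n)"
      using pos by (intro norm_triangle_mono) auto
    also have "\<dots> \<le> lam n * B + gam n * B + del n * B + norm (e n)"
      using pos s B Suc J_bound[OF cs_pos, of n "z n"]
      by (intro add_mono mult_left_mono) (auto simp: B_def)
    also have "\<dots> = B + norm (e n)" using sum1[of n] by (simp flip: distrib_right)
    finally show ?case by (simp add: B_def)
  qed
  with sum_errors[of n] show ?thesis by (simp add: N0_def)
qed

lemma z_bound_N: "norm (z n - s) \<le> real N"
  using z_bound[of n] N_bounds by linarith

section \<open>Displacement of the iterates under the resolvents\<close>

lemma mu_mono: "k \<le> k' \<Longrightarrow> mu k \<le> mu k'"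
  unfolding mu_def
  by (intro max.mono add_mono monoD[OF l_mono] monoD[OF E_mono] mult_le_mono) auto

text \<open>\<open>psi\<close> evaluates \<open>xi\<close> only at the strictest accuracy;
  monotonicity makes that value serve every intermediate stage of the search.\<close>

lemma xi_mono:
  assumes "mono f" "k \<le> k'"
  shows "xi k f \<le> xi k' f"
proof -
  have mu: "mu (2 * k + 1) \<le> mu (2 * k' + 1)" using assms by (intro mu_mono) auto
  have "ftilde (2 * k + 1) f \<le>\<^sup>* ftilde (2 * k' + 1) f"
    unfolding le_star_def ftilde_def using mu
    by (auto intro!: add_mono monoD[OF assms(1)] max.mono)
  then have "chi (4 * a * (k + 1)) (ftilde (2 * k + 1) f) \<le> chi (4 * a * (k' + 1)) (ftilde (2 * k' + 1) f)"
    using chi_mono assms(2) unfolding monotone_functional_def by auto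
  with mu show ?thesis unfolding xi_def by (intro max.mono)
qed

text \<open>Equating the two forms of \<open>z (Suc m)\<close> expresses the displacement, scaled by
  \<open>del m\<close>, through \<open>w m - z m\<close>, \<open>u - z m\<close> and
  \<open>e m\<close>. Beyond \<open>mu\<close> the weight \<open>lam m\<close> is small against
  \<open>1 - gam m\<close>, so \<open>del m\<close> is comparable to the latter and can be divided
  out.\<close>

lemma xi_rate:
  assumes f: "mono f"
  shows "\<exists>n\<le>xi k f. \<forall>m\<in>{n..n + f n}. norm (resolvent T (cs m) (z m) - z m) \<le> 1 / (real k + 1)"
proof -
  define \<mu> where "\<mu> = mu (2 * k + 1)"
  have "mono (ftilde (2 * k + 1) f)"
    unfolding ftilde_def by (auto intro!: monoI monoD[OF f])
  from chi_rate[OF this, of "4 * a * (k + 1)"] obtain n0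
    where n0: "n0 \<le> chi (4 * a * (k + 1)) (ftilde (2 * k + 1) f)"
      and wz: "\<And>m. m \<in> {n0..n0 + ftilde (2 * k + 1) f n0}
        \<Longrightarrow> norm (w m - z m) \<le> 1 / (real (4 * a * (k + 1)) + 1)" by blast
  \<comment> \<open>Raising the start to \<open>\<mu>\<close> is harmless: \<open>ftilde\<close> is
    long enough for \<open>{n..n + f n}\<close> to stay inside the interval obtained from
    \<open>chi\<close>.\<close>
  define n where "n = max \<mu> n0"
  have "n \<le> xi k f" using n0 unfolding n_def \<mu>_def xi_def by (intro max.mono) auto
  moreover have "norm (resolvent T (cs m) (z m) - z m) \<le> 1 / (real k + 1)"
    if m: "m \<in> {n..n + f n}" for m
  proof -
    define K P q X where "K = real a * (real k + 1)" and "P = real N0 + real N3"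
      and "q = 1 - gam m" and "X = norm (resolvent T (cs m) (z m) - z m)"
    have a1: "1 \<le> real a" using a_pos by simp
    have "real a * 1 \<le> K" unfolding K_def by (intro mult_left_mono) auto
    then have K: "real a \<le> K" "1 \<le> K" using a1 by auto
    have P: "1 \<le> P" using N2_pos by (simp add: P_def N0_def)
    have q: "1 / real a \<le> q" using Q3[of m] by (simp add: q_def)
    have lm: "0 < lam m" using lam[of m] by simp
    have "m \<in> {n0..n0 + ftilde (2 * k + 1) f n0}"
      using m unfolding ftilde_def n_def \<mu>_def by (auto simp: max_def split: if_splits)
    have KR: "real (4 * a * (k + 1)) = 4 * K" by (simp add: K_def algebra_simps)
    from wz[OF \<open>m \<in> {n0..n0 + ftilde (2 * k + 1) f n0}\<close>, unfolded KR]
    have wz': "norm (w m - z m) \<le> 1 / (4 * K)"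
      by (rule order_trans) (use K in \<open>auto intro!: divide_left_mono mult_pos_pos\<close>)
    have "l (4 * a * (2 * k + 1 + 1) * (N0 + N3)) \<le> m" "E (4 * a * (2 * k + 1 + 1)) < m"
      using m by (auto simp: n_def \<mu>_def mu_def)
    from Q1[OF this(1)] sum_tail_errors[OF this(2), of "Suc m"]
    have lam_le: "lam m \<le> 1 / (8 * K * P + 1)" and e_le: "norm (e m) \<le> 1 / (8 * K + 1)"
      by (simp_all add: K_def P_def algebra_simps)
    have lP: "lam m * P \<le> 1 / (8 * K)"
    proof -
      have "lam m * P \<le> 1 / (8 * K * P + 1) * P"
        using lam_le P by (intro mult_right_mono) auto
      also have "\<dots> \<le> 1 / (8 * K * P) * P"
        using K P by (intro mult_right_mono divide_left_mono mult_pos_pos add_pos_pos) auto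
      finally show ?thesis using P by simp
    qed
    have e8: "norm (e m) \<le> 1 / (8 * K)"
      using e_le by (rule order_trans) (use K in \<open>auto intro!: divide_left_mono mult_pos_pos\<close>)
    have "lam m * 1 \<le> lam m * P" using P lm by (intro mult_left_mono) auto
    also note lP
    also have "1 / (8 * K) \<le> 1 / real a / 8" using K a1 by (auto simp: field_simps)
    finally have lq: "lam m \<le> q / 8" using q by simp
    have q0: "0 < q" using gam[of m] by (simp add: q_def)
    have Kq: "1 / K \<le> q / (real k + 1)"
      using divide_right_mono[OF q, of "real k + 1"] by (simp add: K_def)
    have Kk: "1 / K \<le> 1 / (real k + 1)"
      using frac_le[OF zero_le_one order_refl _ mult_right_mono[OF a1, of "real k + 1"]]
      by (simp add: K_def)
    have uz: "norm (u - z m) \<le> P"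
      using norm_triangle_ineq4[of "u - s" "z m - s"] s z_bound[of m] by (simp add: P_def)
    have dq: "del m = q - lam m" using sum1[of m] by (simp add: q_def)
    have "del m *\<^sub>R (resolvent T (cs m) (z m) - z m)
        = q *\<^sub>R (w m - z m) - lam m *\<^sub>R (u - z m) - e m"
    proof -
      have "gam m *\<^sub>R z m + q *\<^sub>R w m
          = lam m *\<^sub>R u + gam m *\<^sub>R z m + del m *\<^sub>R resolvent T (cs m) (z m) + e m"
        using z[of m] w[of m] by (simp add: q_def)
      then have "del m *\<^sub>R resolvent T (cs m) (z m) = q *\<^sub>R w m - lam m *\<^sub>R u - e m"
        by (simp add: algebra_simps)
      then show ?thesis by (simp add: scaleR_diff_right) (simp add: dq algebra_simps)
    qed
    moreover have "del m * X = norm (del m *\<^sub>R (resolvent T (cs m) (z m) - z m))"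
      using del[of m] by (simp add: X_def)
    ultimately have "del m * X = norm (q *\<^sub>R (w m - z m) - lam m *\<^sub>R (u - z m) - e m)" by simp
    also have "\<dots> \<le> norm (q *\<^sub>R (w m - z m)) + norm (lam m *\<^sub>R (u - z m)) + norm (e m)"
      by (meson add_right_mono norm_triangle_ineq4 order_trans)
    also have "\<dots> = q * norm (w m - z m) + lam m * norm (u - z m) + norm (e m)"
      using q0 lm by simp
    \<comment> \<open>The first term is at most \<open>q / (4 * (k + 1))\<close>, the other two at
      most half of that each. The total is \<open>q / 2\<close> times the target, matching
      \<open>q / 2 \<le> del m\<close>.\<close>
    also have "\<dots> \<le> q * (1 / (4 * K)) + lam m * P + 1 / (8 * K)"
      using q0 lm wz' uz e8 by (intro add_mono mult_left_mono) auto
    also have "\<dots> \<le> q * (1 / K) / 4 + 1 / K / 4" using lP by simp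
    also have "\<dots> \<le> q * (1 / (real k + 1)) / 4 + q / (real k + 1) / 4"
      using Kq Kk q0 by (intro add_mono divide_right_mono mult_left_mono) auto
    also have "\<dots> = q / 2 * (1 / (real k + 1))"
    proof -
      have "q * y / 4 + q * y / 4 = q / 2 * y" for y :: real by simp
      from this[of "1 / (real k + 1)"] show ?thesis by (simp only: times_divide_eq_right mult_1_right)
    qed
    finally have "del m * X \<le> q / 2 * (1 / (real k + 1))" .
    moreover have "q / 2 * X \<le> del m * X"
      using dq lq q0 by (intro mult_right_mono) (auto simp: X_def)
    ultimately have "q / 2 * X \<le> q / 2 * (1 / (real k + 1))" by linarith
    then have "X \<le> 1 / (real k + 1)" by (rule mult_left_le_imp_le) (use q0 in simp)
    then show ?thesis by (simp add: X_def)
  qed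
  ultimately show ?thesis by blast
qed

text \<open>\<open>1 / real c\<close> is a lower bound of all parameters, so one map can replace the
  whole family: the first bound carries smallness over to it, the second brings it back at the cost
  of a factor.\<close>

lemma displacement_inverse_c:
  "norm (resolvent T (1 / real c) x - x) \<le> norm (resolvent T (cs m) x - x)"
  "norm (resolvent T (cs m) x - x) \<le> cs m * real c * norm (resolvent T (1 / real c) x - x)"
  using resolvent_displacement[OF T _ Q4[of m], of x] c_pos
  by (simp_all add: field_simps)

text \<open>
  If no pair \<open>(n, x)\<close> works, then starting from \<open>s\<close> each approximate fixed point can be replaced
  by a convex combination with some \<open>z j\<close> that is closer to \<open>u\<close> by a fixed amount \<open>\<epsilon>\<close> (in squared
  distance); \<open>R k\<close> such steps exhaust the squared distance from \<open>u\<close> to \<open>s\<close>. Each step degrades the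
  quality of the approximate fixed point, so the tolerances run through the iterates of
  \<open>gcheck f\<close> backwards.
\<close>

lemma psi_rate:
  assumes f: "mono f"
  shows "\<exists>n\<le>psi k f. \<exists>x. norm (x - s) \<le> real N
    \<and> norm (resolvent T (1 / real c) x - x) \<le> 1 / (real (f n) + 1)
    \<and> (\<forall>m\<in>{n..n + (f n + 1)}. (u - x) \<bullet> (z m - x) \<le> 1 / (real k + 1))"
proof (rule ccontr)
  assume contra: "\<not> ?thesis"
  let ?J = "resolvent T (1 / real c)"
  have c0: "0 < 1 / real c" using c_pos by simp
  define r where "r = (\<lambda>j. (gcheck f ^^ j) 0)"
  \<comment> \<open>The gain of \<open>projection_step\<close> for
    \<open>\<eta> = 1 / (k + 1)\<close> and \<open>d = 2 * N\<close>; \<open>R k\<close> is chosen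
    so that \<open>R k * \<epsilon> = N\<^sup>2\<close>.\<close>
  define \<epsilon> where "\<epsilon> = (1 / (real k + 1))\<^sup>2 / (2 * real N)\<^sup>2"
  have gge: "m \<le> gcheck f m" for m
  proof -
    have "m + 1 \<le> (m + 1)\<^sup>2" by (simp add: power2_eq_square)
    moreover have "1 * (m + 1)\<^sup>2 \<le> 24 * N * (m + 1)\<^sup>2"
      using N_bounds by (intro mult_right_mono) auto
    ultimately show ?thesis unfolding gcheck_def by linarith
  qed
  have r_mono: "r i \<le> r j" if "i \<le> j" for i j
    using that by (rule lift_Suc_mono_le[rotated]) (simp add: r_def gge)
  have claim: "\<exists>x. norm (x - s) \<le> real N \<and> norm (?J x - x) \<le> 1 / (real (r (R k - i)) + 1)
      \<and> (norm (u - x))\<^sup>2 \<le> (real N3)\<^sup>2 - real i * \<epsilon>" if "i \<le> R k" for i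
    using that
  proof (induction i)
    case 0
    have "(norm (u - s))\<^sup>2 \<le> (real N3)\<^sup>2" using s by (intro power_mono) auto
    then show ?case using J_fixed[OF c0] by (intro exI[of _ s]) simp
  next
    case (Suc i)
    then obtain x where x: "norm (x - s) \<le> real N" "norm (?J x - x) \<le> 1 / (real (r (R k - i)) + 1)"
      "(norm (u - x))\<^sup>2 \<le> (real N3)\<^sup>2 - real i * \<epsilon>" by auto
    \<comment> \<open>\<open>m\<close> is the accuracy index owed to the next point. For this
      \<open>\<delta>\<close>, both \<open>2 * N * \<delta>\<close> and
      \<open>\<delta>\<^sup>2\<close> are at most \<open>1 / (2 * (m + 1)\<^sup>2)\<close>, which
      pays for one convex combination.\<close>
    define m M \<delta> where "m = r (R k - Suc i)" and "M = 24 * N * (m + 1)\<^sup>2" and "\<delta> = 1 / (real M + 1)"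
    have "R k - i = Suc (R k - Suc i)" using Suc by simp
    then have ri: "r (R k - i) = gcheck f m" by (simp add: r_def m_def)
    have mono1: "mono (\<lambda>i. f i + 1)" using f by (auto simp: mono_def)
    from xi_rate[OF this, of M] obtain n where n: "n \<le> xi M (\<lambda>i. f i + 1)"
      and zn: "\<And>j. j \<in> {n..n + (f n + 1)} \<Longrightarrow> norm (resolvent T (cs j) (z j) - z j) \<le> \<delta>"
      unfolding \<delta>_def by blast
    have "M \<le> 24 * N * (r (R k) + 1)\<^sup>2"
      unfolding M_def m_def by (intro mult_le_mono power_mono add_mono r_mono) auto
    from xi_mono[OF mono1 this] n have n_psi: "n \<le> psi k f" by (simp add: psi_def r_def)
    \<comment> \<open>\<open>gcheck\<close> is a maximum because \<open>x\<close> must be accurate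
      both to \<open>f n\<close>, so that the contrary assumption yields a \<open>j\<close>, and to
      \<open>M\<close>, so that \<open>x\<close> may be combined with \<open>z j\<close>.\<close>
    have "f n \<le> g_of f M" unfolding g_of_def by (rule monoD[OF f n])
    then have rge: "f n \<le> r (R k - i)" "M \<le> r (R k - i)" unfolding ri gcheck_def M_def by auto
    have "norm (?J x - x) \<le> 1 / (real (f n) + 1)"
      using x(2) by (rule order_trans) (use rge in \<open>auto intro!: divide_left_mono\<close>)
    with contra n_psi x(1) obtain j where j: "j \<in> {n..n + (f n + 1)}"
      and big: "1 / (real k + 1) < (u - x) \<bullet> (z j - x)"
      by (meson not_le)
    have x\<delta>: "norm (?J x - x) \<le> \<delta>"
      using x(2) by (rule order_trans) (use rge in \<open>auto simp: \<delta>_def intro!: divide_left_mono\<close>)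
    have z\<delta>: "norm (?J (z j) - z j) \<le> \<delta>"
      using displacement_inverse_c(1) zn[OF j] by (rule order_trans)
    have dist: "norm (z j - x) \<le> 2 * real N"
      using norm_triangle_ineq4[of "z j - s" "x - s"] x(1) z_bound_N[of j] by simp
    have N1: "1 \<le> real N" using N_bounds by simp
    then have "1 \<le> (2 * real N)\<^sup>2" by (intro one_le_power) simp
    moreover have "1 / (real k + 1) \<le> 1" by simp
    ultimately have small: "1 / (real k + 1) \<le> (2 * real N)\<^sup>2" by linarith
    obtain t where t: "0 \<le> t" "t \<le> 1"
      and dec: "(norm (u - ((1 - t) *\<^sub>R x + t *\<^sub>R z j)))\<^sup>2 \<le> (norm (u - x))\<^sup>2 - \<epsilon>"
      using projection_step[OF big _ small dist] unfolding \<epsilon>_def by auto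
    define y where "y = (1 - t) *\<^sub>R x + t *\<^sub>R z j"
    have "y \<in> cball s (real N)"
      unfolding y_def using x(1) z_bound_N[of j] t
      by (intro convexD[OF convex_cball]) (auto simp: dist_norm norm_minus_commute)
    then have "norm (y - s) \<le> real N" by (simp add: dist_norm norm_minus_commute)
    moreover have "norm (?J y - y) \<le> 1 / (real m + 1)"
    proof -
      define q where "q = (real m + 1)\<^sup>2"
      have q: "1 \<le> q" by (simp add: q_def)
      have M: "real M = 24 * real N * q" by (simp add: M_def q_def)
      have "2 * real N * \<delta> \<le> 2 * real N * (1 / (4 * real N * q))"
        unfolding \<delta>_def M using N1 q
        by (intro mult_left_mono divide_left_mono mult_pos_pos add_pos_pos) auto
      then have NM: "2 * real N * \<delta> \<le> 1 / q / 2" using N1 by simp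
      have \<delta>: "0 \<le> \<delta>" "\<delta> \<le> 1" by (simp_all add: \<delta>_def)
      have "\<delta> * \<delta> \<le> \<delta> * (2 * real N)" using \<delta> N1 by (intro mult_left_mono) auto
      then have "\<delta>\<^sup>2 \<le> 1 / q / 2"
        using NM by (simp add: power2_eq_square mult.commute)
      have "(norm (?J y - y))\<^sup>2 \<le> \<delta> * norm (x - z j) + \<delta>\<^sup>2"
        using resolvent_nonexpansive[OF T c0] x\<delta> z\<delta> t y_def by (rule approx_fixed_convex)
      also have "\<dots> \<le> \<delta> * (2 * real N) + \<delta>\<^sup>2"
        using dist by (intro add_right_mono mult_left_mono) (auto simp: \<delta>_def norm_minus_commute)
      also have "\<dots> \<le> 1 / q" using NM \<open>\<delta>\<^sup>2 \<le> 1 / q / 2\<close> by (simp add: mult.commute)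
      also have "\<dots> = (1 / (real m + 1))\<^sup>2" by (simp add: q_def power_divide)
      finally show ?thesis by (rule power2_le_imp_le) simp
    qed
    ultimately show ?case
      using dec x(3) by (intro exI[of _ y]) (auto simp: m_def y_def algebra_simps)
  qed
  from claim[of "R k"] obtain x where "(norm (u - x))\<^sup>2 \<le> (real N3)\<^sup>2 - real (R k) * \<epsilon>" by auto
  moreover have "real (R k) * \<epsilon> = (real N)\<^sup>2"
  proof -
    have "4 * x ^ 4 * y\<^sup>2 * ((1 / y)\<^sup>2 / (2 * x)\<^sup>2) = x\<^sup>2" if "0 < x" "0 < y" for x y :: real
      using that by (simp add: field_simps power2_eq_square power4_eq_xxxx)
    from this[of "real N" "real k + 1"] show ?thesis
      using N_bounds by (simp add: R_def \<epsilon>_def add.commute)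
  qed
  \<comment> \<open>Strictness makes the squared distance after \<open>R k\<close> moves
    negative.\<close>
  moreover have "(real N3)\<^sup>2 < (real N)\<^sup>2"
    using N_bounds by (intro power_strict_mono) auto
  ultimately show False by (smt (verit) zero_le_power2)
qed

text \<open>In \<open>h_of\<close> the factor \<open>C (f n) * c\<close> passes from the parameter
  \<open>1 / c\<close> to every \<open>cs i\<close> with \<open>i \<le> f n\<close>; the remaining
  factor is the accuracy at which one step of the recursion costs \<open>1 / (f n + 1)\<close>. The
  index \<open>2 * k + 1\<close> halves the inner product bound, which the recursion
  doubles.\<close>

lemma Psi_rate:
  assumes f: "mono f"
  shows "\<exists>n\<le>Psi k f. \<exists>x. norm (x - s) \<le> real N
    \<and> (\<forall>i\<le>f n. norm (resolvent T (cs i) x - x) \<le> 1 / ((1 + 4 * real N) * (real (f n) + 1)))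
    \<and> (\<forall>m\<in>{n..f n + 1}. (u - x) \<bullet> (z m - x) \<le> 1 / (2 * (real k + 1)))"
proof -
  define K where "K = (\<lambda>m. (1 + 4 * N) * (f m + 1))"
  have K: "1 \<le> K m" "f m \<le> K m" for m by (auto simp: K_def)
  have Cpos: "1 \<le> C i" for i using less_le_trans[OF cs_pos C, of i] by simp
  have c1: "1 \<le> c" using c_pos by simp
  have h_eq: "h_of f m = C (f m) * c * K m - 1" for m
    using K[of m] by (simp add: h_of_def zeta_def K_def)
  have pos: "1 \<le> C (f m) * c * K m" for m using Cpos[of "f m"] c1 K[of m] by simp
  have "mono (h_of f)"
    unfolding h_eq[abs_def] K_def
    by (intro monoI diff_le_mono mult_le_mono monoD[OF C_mono] monoD[OF f] add_mono) auto
  from psi_rate[OF this, of "2 * k + 1"] obtain n x where n: "n \<le> Psi k f"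
    and x: "norm (x - s) \<le> real N"
      "norm (resolvent T (1 / real c) x - x) \<le> 1 / (real (h_of f n) + 1)"
      "\<And>m. m \<in> {n..n + (h_of f n + 1)} \<Longrightarrow> (u - x) \<bullet> (z m - x) \<le> 1 / (real (2 * k + 1) + 1)"
    unfolding Psi_def by blast
  have h1: "h_of f n + 1 = C (f n) * c * K n" using pos[of n] by (simp add: h_eq)
  then have h1r: "real (h_of f n) + 1 = real (C (f n)) * real c * real (K n)"
    by (metis of_nat_1 of_nat_add of_nat_mult)
  have "norm (resolvent T (cs i) x - x) \<le> 1 / real (K n)" if i: "i \<le> f n" for i
  proof -
    have "cs i \<le> real (C (f n))" using C[of i] monoD[OF C_mono i] by simp
    then have "cs i * real c * norm (resolvent T (1 / real c) x - x)
        \<le> real (C (f n)) * real c * (1 / (real (h_of f n) + 1))"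
      using x(2) cs_pos[of i] by (intro mult_mono) auto
    also have "\<dots> = 1 / real (K n)" unfolding h1r using Cpos[of "f n"] c1 by simp
    finally show ?thesis using displacement_inverse_c(2)[of i x] by linarith
  qed
  moreover have "(u - x) \<bullet> (z m - x) \<le> 1 / (2 * (real k + 1))" if m: "m \<in> {n..f n + 1}" for m
  proof -
    have "1 * 1 * (f n + 1) \<le> C (f n) * c * K n"
      using Cpos[of "f n"] c1 by (intro mult_le_mono) (auto simp: K_def)
    then have "m \<in> {n..n + (h_of f n + 1)}" using m h1 by auto
    from x(3)[OF this] show ?thesis by (simp add: algebra_simps)
  qed
  moreover have "real (K n) = (1 + 4 * real N) * (real (f n) + 1)"
    by (simp add: K_def algebra_simps)
  ultimately show ?thesis using n x(1) by metis
qed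

section \<open>The recursion for the squared distances and the resulting rates\<close>

lemma prod_one_minus_lam_le: "(\<Prod>i\<in>A. 1 - lam i) \<le> exp (- (\<Sum>i\<in>A. lam i))"
proof (cases "finite A")
  case True
  have "(\<Prod>i\<in>A. 1 - lam i) \<le> (\<Prod>i\<in>A. exp (- lam i))"
  proof (intro prod_mono conjI)
    fix i show "0 \<le> 1 - lam i" using lam[of i] by simp
    show "1 - lam i \<le> exp (- lam i)" using exp_ge_add_one_self[of "- lam i"] by simp
  qed
  also have "\<dots> = exp (- (\<Sum>i\<in>A. lam i))" using True by (simp add: exp_sum flip: sum_negf)
  finally show ?thesis .
\<comment> \<open>For infinite \<open>A\<close> the product and the sum take their default values 1
  and 0.\<close>
qed simp

text \<open>With \<open>v = y - (lam m *\<^sub>R (u - x) + e m)\<close> one has \<open>(norm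
  y)\<^sup>2 \<le> (norm v)\<^sup>2 + 2 * ((y - v) \<bullet> y)\<close>. The divisor
  \<open>1 + 4 * real N\<close> is due to \<open>b \<le> 2 * real N\<close>: an error
  \<open>\<theta>\<close> in a distance \<open>b\<close> changes its square by at most
  \<open>(1 + 4 * real N) * \<theta>\<close>.\<close>

lemma Suc_dist_le:
  assumes x: "norm (x - s) \<le> real N" and \<eta>: "0 \<le> \<eta>" "\<eta> \<le> 1"
    and Jx: "norm (resolvent T (cs m) x - x) \<le> \<eta> / (1 + 4 * real N)"
    and ux: "(u - x) \<bullet> (z (Suc m) - x) \<le> \<beta>"
  shows "(norm (z (Suc m) - x))\<^sup>2
    \<le> (1 - lam m) * ((norm (z m - x))\<^sup>2 + \<eta>) + 2 * lam m * \<beta> + 4 * real N * norm (e m)"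
proof -
  define b where "b = norm (z m - x)"
  define \<theta> where "\<theta> = \<eta> / (1 + 4 * real N)"
  define v where "v = gam m *\<^sub>R (z m - x) + del m *\<^sub>R (resolvent T (cs m) (z m) - x)"
  define y where "y = z (Suc m) - x"
  have pos: "0 < lam m" "0 < gam m" "0 < del m" "lam m < 1"
    using lam[of m] gam[of m] del[of m] by auto
  have dist: "norm (z j - x) \<le> 2 * real N" for j
    using norm_triangle_ineq4[of "z j - s" "x - s"] x z_bound_N[of j] by simp
  have b: "0 \<le> b" "b \<le> 2 * real N" using dist[of m] by (simp_all add: b_def)
  have \<theta>: "0 \<le> \<theta>" "\<theta> \<le> 1" "(1 + 4 * real N) * \<theta> = \<eta>"
    using \<eta> by (auto simp: \<theta>_def field_simps)
  have Jz: "norm (resolvent T (cs m) (z m) - x) \<le> b + \<theta>"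
    using norm_triangle_ineq[of "resolvent T (cs m) (z m) - resolvent T (cs m) x"
        "resolvent T (cs m) x - x"] resolvent_nonexpansive[OF T cs_pos, of m "z m" x] Jx
    by (simp add: b_def \<theta>_def)
  have "norm v \<le> gam m * b + del m * (b + \<theta>)"
    unfolding v_def using Jz pos by (intro norm_triangle_mono) (auto simp: b_def)
  also have "\<dots> \<le> gam m * (b + \<theta>) + del m * (b + \<theta>)"
    using \<theta> pos by (intro add_right_mono mult_left_mono) auto
  also have "\<dots> = (1 - lam m) * (b + \<theta>)" using sum1[of m] by (simp flip: distrib_right)
  finally have "(norm v)\<^sup>2 \<le> ((1 - lam m) * (b + \<theta>))\<^sup>2" by (intro power_mono) auto
  also have "\<dots> = (1 - lam m) * ((1 - lam m) * (b + \<theta>)\<^sup>2)" by (simp add: power2_eq_square)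
  also have "\<dots> \<le> (1 - lam m) * (1 * (b + \<theta>)\<^sup>2)"
    using pos by (intro mult_left_mono mult_right_mono) auto
  also have "\<dots> \<le> (1 - lam m) * (b\<^sup>2 + \<eta>)"
  proof -
    have "(b + \<theta>)\<^sup>2 = b\<^sup>2 + (2 * b + \<theta>) * \<theta>" by (simp add: power2_eq_square algebra_simps)
    also have "\<dots> \<le> b\<^sup>2 + (1 + 4 * real N) * \<theta>"
      using b \<theta> by (intro add_left_mono mult_right_mono) auto
    finally show ?thesis using \<theta> pos by (intro mult_left_mono) auto
  qed
  finally have v2: "(norm v)\<^sup>2 \<le> (1 - lam m) * (b\<^sup>2 + \<eta>)" .
  have "lam m *\<^sub>R x + gam m *\<^sub>R x + del m *\<^sub>R x = x"
    using sum1[of m] by (simp flip: scaleR_add_left)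
  then have yv: "v = y - (lam m *\<^sub>R (u - x) + e m)"
    unfolding v_def y_def z by (simp add: algebra_simps)
  have "(norm y)\<^sup>2 = (norm v)\<^sup>2 + 2 * ((lam m *\<^sub>R (u - x) + e m) \<bullet> y)
      - (norm (lam m *\<^sub>R (u - x) + e m))\<^sup>2"
    unfolding yv power2_norm_eq_inner by (simp add: inner_diff_left inner_diff_right inner_commute)
  also have "\<dots> \<le> (norm v)\<^sup>2 + 2 * (lam m * ((u - x) \<bullet> y) + e m \<bullet> y)"
    by (simp add: inner_add_left)
  also have "\<dots> \<le> (1 - lam m) * (b\<^sup>2 + \<eta>) + 2 * (lam m * \<beta> + norm (e m) * (2 * real N))"
  proof -
    have "e m \<bullet> y \<le> norm (e m) * norm y" by (rule norm_cauchy_schwarz)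
    also have "\<dots> \<le> norm (e m) * (2 * real N)"
      unfolding y_def by (intro mult_left_mono dist) auto
    finally have "e m \<bullet> y \<le> norm (e m) * (2 * real N)" .
    moreover have "lam m * ((u - x) \<bullet> y) \<le> lam m * \<beta>"
      using ux pos by (intro mult_left_mono) (auto simp: y_def)
    ultimately show ?thesis using v2 ux pos
      by (intro add_mono mult_left_mono) (auto simp: y_def)
  qed
  finally show ?thesis by (simp add: y_def b_def algebra_simps)
qed

text \<open>Four contributions get a quarter \<open>A\<close> each: the damped initial distance, the
  inner products, the inaccuracy of \<open>x\<close> as a fixed point, and the errors
  \<open>e i\<close>. That \<open>x\<close> does not depend on \<open>m\<close> lets it serve as a
  common centre for two iterates.\<close>

lemma Theta_rate:
  assumes f: "mono f"
  shows "\<exists>n\<le>Theta k f. \<exists>x. \<forall>m\<in>{n..f n}. (norm (z m - x))\<^sup>2 \<le> 1 / (real k + 1)"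
proof -
  define A where "A = 1 / (4 * (real k + 1))"
  have h'_mono: "mono (h' k)" unfolding h'_def by (auto intro!: monoI)
  have "mono (g' k f)"
    unfolding g'_def
    by (intro monoI mult_le_mono add_mono monoD[OF f] monoD[OF L_mono] monoD[OF h'_mono]) auto
  from Psi_rate[OF this, of "4 * k + 3"] obtain n0 x where n0: "n0 \<le> Psi (4 * k + 3) (g' k f)"
    and x: "norm (x - s) \<le> real N"
    and Jx: "\<And>i. i \<le> g' k f n0 \<Longrightarrow>
      norm (resolvent T (cs i) x - x) \<le> 1 / ((1 + 4 * real N) * (real (g' k f n0) + 1))"
    and ux: "\<And>m. m \<in> {n0..g' k f n0 + 1} \<Longrightarrow>
      (u - x) \<bullet> (z m - x) \<le> 1 / (2 * (real (4 * k + 3) + 1))" by blast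
  \<comment> \<open>From \<open>n1\<close> on the error tail is small. Up to \<open>L K\<close> the
    \<open>lam i\<close> sum to at least \<open>n1 + p\<close>; the indices below \<open>n1\<close>
    contribute at most \<open>n1 - 1\<close>, so at least \<open>p\<close> remains for damping the
    initial bound \<open>D = (2 * N)\<^sup>2\<close>.\<close>
  define n1 K n where "n1 = max n0 (G (4 * k + 3) + 1)" and "K = h' k n0" and "n = L K + 1"
  define p \<eta> where "p = nat \<lceil>ln (real (4 * D * (k + 1)))\<rceil>" and "\<eta> = 1 / (real (g' k f n0) + 1)"
  have K: "K = n1 + p" by (simp add: K_def h'_def n1_def p_def)
  have g': "g' k f n0 = 4 * (k + 1) * (f n + 1)" by (simp add: g'_def n_def K_def)
  have \<eta>: "0 \<le> \<eta>" "\<eta> \<le> 1" by (auto simp: \<eta>_def)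
  have "n \<le> Theta k f"
    unfolding n_def K_def Theta_def
    by (intro add_mono monoD[OF L_mono] monoD[OF h'_mono] n0) auto
  have rec: "(norm (z m - x))\<^sup>2 \<le> (\<Prod>i=n1..<m. 1 - lam i) * real D + A + real (m - n1) * \<eta>
      + 4 * real N * (\<Sum>i=n1..<m. norm (e i))" if "n1 \<le> m" "m \<le> g' k f n0 + 1" for m
    using that
  proof (induction rule: dec_induct)
    case base
    have "norm (z n1 - x) \<le> 2 * real N"
      using norm_triangle_ineq4[of "z n1 - s" "x - s"] x z_bound_N[of n1] by simp
    then have "(norm (z n1 - x))\<^sup>2 \<le> (2 * real N)\<^sup>2" by (intro power_mono) auto
    moreover have "0 \<le> A" by (simp add: A_def)
    ultimately show ?case by (simp add: D_def)
  next
    case (step m)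
    define Q where "Q = (\<Prod>i=n1..<m. 1 - lam i) * real D"
    define S where "S = 4 * real N * (\<Sum>i=n1..<m. norm (e i))"
    have lm: "0 < lam m" "lam m < 1" using lam[of m] by auto
    have S: "0 \<le> S" by (simp add: S_def sum_nonneg)
    have "(norm (z (Suc m) - x))\<^sup>2
        \<le> (1 - lam m) * ((norm (z m - x))\<^sup>2 + \<eta>) + 2 * lam m * (A / 2) + 4 * real N * norm (e m)"
    proof (rule Suc_dist_le[OF x \<eta>])
      show "norm (resolvent T (cs m) x - x) \<le> \<eta> / (1 + 4 * real N)"
        using Jx[of m] step.prems by (simp add: \<eta>_def mult.commute)
      have "Suc m \<in> {n0..g' k f n0 + 1}" using step by (auto simp: n1_def)
      from ux[OF this] show "(u - x) \<bullet> (z (Suc m) - x) \<le> A / 2"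
        by (simp add: A_def algebra_simps)
    qed
    also have "\<dots> \<le> (1 - lam m) * ((Q + A + real (m - n1) * \<eta> + S) + \<eta>)
        + 2 * lam m * (A / 2) + 4 * real N * norm (e m)"
      using step lm unfolding Q_def S_def by (intro add_right_mono mult_left_mono) auto
    \<comment> \<open>\<open>A\<close> reproduces itself as
      \<open>(1 - lam m) * A + lam m * A\<close>; the per-step errors simply add up.\<close>
    also have "\<dots> = (1 - lam m) * Q + A + (1 - lam m) * ((real (m - n1) * \<eta> + S) + \<eta>)
        + 4 * real N * norm (e m)"
      by (simp add: algebra_simps)
    also have "\<dots> \<le> (1 - lam m) * Q + A + 1 * ((real (m - n1) * \<eta> + S) + \<eta>)
        + 4 * real N * norm (e m)"
      using lm S \<eta> by (intro add_right_mono add_left_mono mult_right_mono) auto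
    also have "\<dots> = (\<Prod>i=n1..<Suc m. 1 - lam i) * real D + A + real (Suc m - n1) * \<eta>
        + 4 * real N * (\<Sum>i=n1..<Suc m. norm (e i))"
      using step.hyps by (simp add: Q_def S_def Suc_diff_le algebra_simps)
    finally show ?case .
  qed
  have "(norm (z m - x))\<^sup>2 \<le> 1 / (real k + 1)" if m: "m \<in> {n..f n}" for m
  proof -
    have "real K \<le> (\<Sum>i=1..L K. lam i)" by (rule Q2)
    also have "\<dots> \<le> (\<Sum>i=1..L K. 1)"
      using lam by (intro sum_mono) (auto intro: less_imp_le)
    finally have LK: "n1 \<le> L K" using K by simp
    then have nm: "n1 \<le> m" using m by (auto simp: n_def)
    have "1 * (f n + 1) \<le> 4 * (k + 1) * (f n + 1)" by (intro mult_le_mono) auto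
    then have "f n \<le> g' k f n0" by (simp add: g')
    then have "(norm (z m - x))\<^sup>2 \<le> (\<Prod>i=n1..<m. 1 - lam i) * real D + A + real (m - n1) * \<eta>
        + 4 * real N * (\<Sum>i=n1..<m. norm (e i))"
      using nm m by (intro rec) auto
    also have "(\<Prod>i=n1..<m. 1 - lam i) * real D \<le> A"
    proof -
      have D: "1 \<le> D" using N_bounds by (simp add: D_def)
      then have "0 < 4 * D * (k + 1)" by simp
      then have "0 < real (4 * D * (k + 1))" by (simp only: of_nat_0_less_iff)
      have n1: "1 \<le> n1" by (simp add: n1_def)
      have "(\<Sum>i=1..L K. lam i) \<le> (\<Sum>i\<in>{1..<n1} \<union> {n1..<m}. lam i)"
        using lam m by (intro sum_mono2) (auto simp: n_def intro: less_imp_le)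
      also have "\<dots> = (\<Sum>i=1..<n1. lam i) + (\<Sum>i=n1..<m. lam i)"
        by (intro sum.union_disjoint) auto
      also have "(\<Sum>i=1..<n1. lam i) \<le> (\<Sum>i=1..<n1. 1)"
        using lam by (intro sum_mono) (auto intro: less_imp_le)
      finally have "real p \<le> (\<Sum>i=n1..<m. lam i)"
        using Q2[of K] n1 by (simp add: K)
      moreover have "ln (real (4 * D * (k + 1))) \<le> real p" unfolding p_def by (rule real_nat_ceiling_ge)
      ultimately have "exp (- (\<Sum>i=n1..<m. lam i)) \<le> exp (- ln (real (4 * D * (k + 1))))" by simp
      also have "\<dots> = 1 / real (4 * D * (k + 1))"
        using \<open>0 < real (4 * D * (k + 1))\<close> by (simp add: exp_minus inverse_eq_divide)
      finally have "(\<Prod>i=n1..<m. 1 - lam i) \<le> 1 / real (4 * D * (k + 1))"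
        using prod_one_minus_lam_le by (rule order_trans[rotated])
      then have "(\<Prod>i=n1..<m. 1 - lam i) * real D \<le> 1 / real (4 * D * (k + 1)) * real D"
        by (rule mult_right_mono) simp
      also have "real (4 * D * (k + 1)) = real D * (4 * (real k + 1))" by (simp add: algebra_simps)
      also have "1 / \<dots> * real D = A" using D by (simp add: A_def)
      finally show ?thesis .
    qed
    \<comment> \<open>There are at most \<open>f n\<close> steps, which is what the factor
      \<open>f n + 1\<close> in \<open>g'\<close> provides for.\<close>
    also have "real (m - n1) * \<eta> \<le> A"
    proof -
      have "real (m - n1) * \<eta> \<le> (real (f n) + 1) * \<eta>"
        using m \<eta> by (intro mult_right_mono) auto
      also have "\<dots> \<le> (real (f n) + 1) * (1 / real (g' k f n0))"
      proof -
        have "0 < g' k f n0" by (simp add: g')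
        then show ?thesis unfolding \<eta>_def
          by (intro mult_left_mono divide_left_mono mult_pos_pos) auto
      qed
      also have "real (g' k f n0) = (real (f n) + 1) * (4 * (real k + 1))"
        by (simp add: g' algebra_simps)
      also have "(real (f n) + 1) * (1 / \<dots>) = A" by (simp add: A_def add_nonneg_eq_0_iff)
      finally show ?thesis .
    qed
    also have "4 * real N * (\<Sum>i=n1..<m. norm (e i)) \<le> A"
    proof -
      define q where "q = M2 * (4 * k + 3 + 1)"
      have "E q < n1" by (simp add: n1_def G_def q_def)
      from sum_tail_errors[OF this, of m]
      have "4 * real N * (\<Sum>i=n1..<m. norm (e i)) \<le> 4 * real N * (1 / (real q + 1))"
        by (rule mult_left_mono) simp
      also have "\<dots> \<le> 4 * real N * (1 / (4 * real N * (4 * (real k + 1))))"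
      proof (intro mult_left_mono divide_left_mono)
        have "4 * N * (4 * (k + 1)) \<le> q"
          unfolding q_def M2_def M1_def by (intro mult_le_mono) auto
        then have "real (4 * N * (4 * (k + 1))) \<le> real q" by (simp only: of_nat_le_iff)
        then show "4 * real N * (4 * (real k + 1)) \<le> real q + 1" by (simp add: algebra_simps)
      qed (use N_bounds in auto)
      also have "\<dots> = A" using N_bounds by (simp add: A_def)
      finally show ?thesis .
    qed
    finally have "(norm (z m - x))\<^sup>2 \<le> A + A + A + A" by simp
    also have "\<dots> = 1 / (real k + 1)"
    proof -
      have "1 / (4 * y) + 1 / (4 * y) + 1 / (4 * y) + 1 / (4 * y) = 1 / y" for y :: real
        by (cases "y = 0") (auto simp: field_simps)
      then show ?thesis unfolding A_def .
    qed
    finally show ?thesis .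
  qed
  with \<open>n \<le> Theta k f\<close> show ?thesis by blast
qed

text \<open>Both iterates lie within \<open>1 / (2 * (k + 1))\<close> of the same point; squaring
  this radius gives the index \<open>4 * (k + 1)\<^sup>2 - 1\<close>. \<open>Theta_rate\<close>
  covers \<open>{n..f n}\<close>, hence the function \<open>m + f m\<close>.\<close>

theorem phi_rate:
  assumes f: "mono f"
  shows "\<exists>n\<le>phi k f. \<forall>i\<in>{n..n + f n}. \<forall>j\<in>{n..n + f n}. norm (z i - z j) \<le> 1 / (real k + 1)"
proof -
  have "mono (\<lambda>m. m + f m)" by (intro monoI add_mono monoD[OF f])
  from Theta_rate[OF this, of "4 * (k + 1)\<^sup>2 - 1"] obtain n x where n: "n \<le> phi k f"
    and zx: "\<And>m. m \<in> {n..n + f n} \<Longrightarrow>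
      (norm (z m - x))\<^sup>2 \<le> 1 / (real (4 * (k + 1)\<^sup>2 - 1) + 1)"
    unfolding phi_def by blast
  have "real (4 * (k + 1)\<^sup>2 - 1) + 1 = 4 * (real k + 1)\<^sup>2"
    by (simp add: of_nat_diff add.commute)
  then have eq: "1 / (real (4 * (k + 1)\<^sup>2 - 1) + 1) = (1 / (2 * (real k + 1)))\<^sup>2"
    by (simp add: power2_eq_square field_simps)
  have half: "norm (z m - x) \<le> 1 / (2 * (real k + 1))" if "m \<in> {n..n + f n}" for m
    using zx[OF that] unfolding eq by (rule power2_le_imp_le) simp
  have "norm (z i - z j) \<le> 1 / (real k + 1)" if "i \<in> {n..n + f n}" "j \<in> {n..n + f n}" for i j
  proof -
    have "norm (z i - z j) \<le> norm (z i - x) + norm (z j - x)"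
      using norm_triangle_ineq4[of "z i - x" "z j - x"] by simp
    also have "\<dots> \<le> 1 / (2 * (real k + 1)) + 1 / (2 * (real k + 1))"
      using half that by (intro add_mono) auto
    also have "\<dots> = 1 / (real k + 1)" by (simp add: field_simps)
    finally show ?thesis .
  qed
  with n show ?thesis by blast
qed

end

theorem theorem4p6:
  fixes T :: "'a::{real_inner, complete_space} \<Rightarrow> 'a set"
    and u :: 'a
    and z w e :: "nat \<Rightarrow> 'a"
    and cs lam gam del :: "nat \<Rightarrow> real"
    and a c N2 N3 :: nat
    and l L E C :: "nat \<Rightarrow> nat"
    and chi :: "nat \<Rightarrow> (nat \<Rightarrow> nat) \<Rightarrow> nat"
  assumes T: "maximal_monotone T"
    and S: "op_inverse T 0 \<noteq> {}"
    and cs_pos: "\<And>n. 0 < cs n"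
    and lam: "\<And>n. lam n \<in> {0<..<1}"
    and gam: "\<And>n. gam n \<in> {0<..<1}"
    and del: "\<And>n. del n \<in> {0<..<1}"
    and sum1: "\<And>n. lam n + gam n + del n = 1"
    and z: "\<And>n. z (Suc n) =
              lam n *\<^sub>R u + gam n *\<^sub>R z n + del n *\<^sub>R resolvent T (cs n) (z n) + e n"
    and a_pos: "a \<noteq> 0"
    and c_pos: "c \<noteq> 0"
    and l_mono: "mono l"
    and L_mono: "mono L"
    and E_mono: "mono E"
    and Q1: "\<And>k n. l k \<le> n \<Longrightarrow> lam n \<le> 1 / (real k + 1)"
    and Q2: "\<And>k. real k \<le> (\<Sum>i=1..L k. lam i)"
    and Q3: "\<And>m. 1 / real a \<le> gam m \<and> gam m \<le> 1 - 1 / real a"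
    and Q4: "\<And>n. 1 / real c \<le> cs n"
    and Q6: "\<And>k n. (\<Sum>i=E k + 1..E k + n. norm (e i)) \<le> 1 / (real k + 1)"
    and C_mono: "mono C"
    and C: "\<And>n. cs n \<le> real (C n)"
    and N2: "(\<Sum>i=0..E 0. norm (e i)) + 1 \<le> real N2"
    and N3: "\<exists>s\<in>op_inverse T 0. max (norm (u - s)) (norm (z 0 - s)) \<le> real N3"
    and w: "\<And>n. z (Suc n) = gam n *\<^sub>R z n + (1 - gam n) *\<^sub>R w n"
    and chi_mono: "monotone_functional chi"
    and chi_rate: "\<And>k f. mono f \<Longrightarrow>
                \<exists>n\<le>chi k f. \<forall>m\<in>{n..n + f n}. norm (w m - z m) \<le> 1 / (real k + 1)"
  shows "\<forall>k. \<forall>f. mono f \<longrightarrow>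
           (\<exists>n\<le>rates.phi a c N2 N3 l L E C chi k f.
              \<forall>i\<in>{n..n + f n}. \<forall>j\<in>{n..n + f n}. norm (z i - z j) \<le> 1 / (real k + 1))"
proof -
  obtain s where "s \<in> op_inverse T 0" "max (norm (u - s)) (norm (z 0 - s)) \<le> real N3"
    using N3 by blast
  then interpret multi_parameter_ppa a c N2 N3 l L E C chi T u s z w e cs lam gam del
    using T cs_pos lam gam del sum1 z a_pos c_pos l_mono L_mono E_mono Q1 Q2 Q3 Q4 Q6
      C_mono C N2 w chi_mono chi_rate
    by (intro multi_parameter_ppa.intro) simp_all
  show ?thesis using phi_rate by blast
qed

end
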